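(* Let $\mathbb{F}$ be an infinite field. Then for all $m>0$: - if $\mathrm{char}\,\mathbb{F}=2$, the set $$S_{2,m}^{(2)}=\{\mathrm{tr}(Y_iY_j)\mid1\le i<j\le m\}$$ is a minimal separating set for the algebra $\mathcal{O}(\mathcal{N}_2^m)^{\mathrm{GL}_2}$ of invariant polynomial functions on $m$-tuples of nilpotent $2\times2$ matrices; - if $\mathrm{char}\,\mathbb{F}\ne2$, the set $$S_{2,m}=\{\mathrm{tr}(Y_iY_j)\mid1\le i<j\le m\}\cup\{\mathrm{tr}(Y_iY_jY_k)\mid1\le i<j<k\le m\}$$ is a minimal separating set for $\mathcal{O}(\mathcal{N}_2^m)^{\mathrm{GL}_2}$.
   Context: $\mathcal{N}_2$ is the set of all nilpotent $2\times2$ matrices over $\mathbb{F}$. The group $\mathrm{GL}_2=\mathrm{GL}_2(\mathbb{F})$ acts on $\mathcal{N}_2^m$ by simultaneous conjugation: $g\cdot(A_1,\ldots,A_m)=(gA_1g^{-1},\ldots,gA_mg^{-1})$. $\mathcal{O}(\mathcal{N}_2^m)$ is the $\mathbb{F}$-algebra of functions $\mathcal{N}_2^m\to\mathbb{F}$ generated by the entry functions $y_{ij}(k):(A_1,\ldots,A_m)\mapsto(A_k)_{ij}$ ($1\le i,j\le2$, $1\le k\le m$), and $\mathcal{O}(\mathcal{N}_2^m)^{\mathrm{GL}_2}$ is the subalgebra of functions constant on $\mathrm{GL}_2$-orbits. $Y_k=(y_{ij}(k))_{1\le i,j\le2}$ is the generic nilpotent matrix, so e.g. $\mathrm{tr}(Y_iY_j)$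 is the function $(A_1,\ldots,A_m)\mapsto\mathrm{tr}(A_iA_j)$. Two points are separated by a set $S$ of invariant functions if some $f\in S$ takes different values at them; $S\subset\mathcal{O}(\mathcal{N}_2^m)^{\mathrm{GL}_2}$ is separating if any two points separated by $\mathcal{O}(\mathcal{N}_2^m)^{\mathrm{GL}_2}$ are separated by $S$. A separating set is minimal if it is minimal with respect to inclusion. *)

theory Defs
  imports "HOL-Analysis.Analysis"
begin

(* The library's power on 'a^'n^'n is componentwise, so the matrix power is an iterate of **. *)
definition nilpotent_matrix :: "'a::semiring_1^'n^'n \<Rightarrow> bool" where
  "nilpotent_matrix A \<longleftrightarrow> (\<exists>k. (((**) A) ^^ k) (mat 1) = 0)"

(* m-tuples are indexed by 1, ..., m and are undefined outside this range, so that
   equality of tuples is HOL equality. *)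
definition nil_tuples :: "nat \<Rightarrow> (nat \<Rightarrow> 'a::field^2^2) set" where
  "nil_tuples m = {1..m} \<rightarrow>\<^sub>E {A. nilpotent_matrix A}"

definition conj_act :: "nat \<Rightarrow> 'a::field^2^2 \<Rightarrow> (nat \<Rightarrow> 'a^2^2) \<Rightarrow> (nat \<Rightarrow> 'a^2^2)" where
  "conj_act m g A = (\<lambda>k\<in>{1..m}. g ** A k ** matrix_inv g)"

(* Functions on nil_tuples m are likewise undefined outside their domain. *)
inductive_set coord_algebra :: "nat \<Rightarrow> ((nat \<Rightarrow> 'a::field^2^2) \<Rightarrow> 'a) set" for m :: nat where
  const: "(\<lambda>A\<in>nil_tuples m. c) \<in> coord_algebra m"
| entry: "k \<in> {1..m} \<Longrightarrow> (\<lambda>A\<in>nil_tuples m. A k $ i $ j) \<in> coord_algebra m"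
| add: "\<lbrakk>f \<in> coord_algebra m; h \<in> coord_algebra m\<rbrakk>
        \<Longrightarrow> (\<lambda>A\<in>nil_tuples m. f A + h A) \<in> coord_algebra m"
| mult: "\<lbrakk>f \<in> coord_algebra m; h \<in> coord_algebra m\<rbrakk>
        \<Longrightarrow> (\<lambda>A\<in>nil_tuples m. f A * h A) \<in> coord_algebra m"

definition invariant_algebra :: "nat \<Rightarrow> ((nat \<Rightarrow> 'a::field^2^2) \<Rightarrow> 'a) set" where
  "invariant_algebra m =
     {f \<in> coord_algebra m. \<forall>g. \<forall>A\<in>nil_tuples m. invertible g \<longrightarrow> f (conj_act m g A) = f A}"

definition separates :: "('b \<Rightarrow> 'a) set \<Rightarrow> 'b \<Rightarrow> 'b \<Rightarrow> bool" where
  "separates S x y \<longleftrightarrow> (\<exists>f\<in>S. f x \<noteq> f y)"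

definition separating_set :: "nat \<Rightarrow> ((nat \<Rightarrow> 'a::field^2^2) \<Rightarrow> 'a) set \<Rightarrow> bool" where
  "separating_set m S \<longleftrightarrow> S \<subseteq> invariant_algebra m \<and>
     (\<forall>A\<in>nil_tuples m. \<forall>B\<in>nil_tuples m.
        separates (invariant_algebra m) A B \<longrightarrow> separates S A B)"

definition minimal_separating_set :: "nat \<Rightarrow> ((nat \<Rightarrow> 'a::field^2^2) \<Rightarrow> 'a) set \<Rightarrow> bool" where
  "minimal_separating_set m S \<longleftrightarrow>
     separating_set m S \<and> (\<forall>T. T \<subset> S \<longrightarrow> \<not> separating_set m T)"

definition trace_pairs :: "nat \<Rightarrow> ((nat \<Rightarrow> 'a::field^2^2) \<Rightarrow> 'a) set" where
  "trace_pairs m =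
     {\<lambda>A\<in>nil_tuples m. trace (A i ** A j) |i j. 1 \<le> i \<and> i < j \<and> j \<le> m}"

definition trace_triples :: "nat \<Rightarrow> ((nat \<Rightarrow> 'a::field^2^2) \<Rightarrow> 'a) set" where
  "trace_triples m =
     {\<lambda>A\<in>nil_tuples m. trace (A i ** A j ** A k) |i j k. 1 \<le> i \<and> i < j \<and> j < k \<and> k \<le> m}"

end

theory Submission
  imports Defs
begin

text \<open>If all traces of pairs vanish, the matrices of the tuple are proportional to one nilpotent
  matrix, so every nonzero rescaling of the tuple is conjugate to it. As the field is infinite, a
  polynomial invariant is then constant in the scaling parameter and takes its value at the zero
  tuple. If instead the trace of some \<open>A\<^sub>i A\<^sub>j\<close> is a nonzero \<open>c\<close>, a conjugation turns \<open>A\<^sub>i, A\<^sub>j\<close>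
  into \<open>E\<^sub>1\<^sub>2, c E\<^sub>2\<^sub>1\<close>, and any other \<open>A\<^sub>k\<close> has its off-diagonal entries determined by pair
  traces and its diagonal entry \<open>p\<close> by a triple trace \<open>\<plusminus> c p\<close>. In characteristic 2 the
  equation \<open>p\<^sup>2 = - q r\<close> already determines \<open>p\<close>. So equal traces force conjugate tuples.
  Minimality is witnessed by tuples supported on two or three indices.\<close>

section \<open>Two-by-two matrices and nilpotency\<close>

definition mat2 :: "'a \<Rightarrow> 'a \<Rightarrow> 'a \<Rightarrow> 'a \<Rightarrow> 'a::field^2^2" where
  "mat2 a b c d = vector [vector [a, b], vector [c, d]]"

lemma mat2_nth [simp]:
  "mat2 a b c d $ 1 $ 1 = a" "mat2 a b c d $ 1 $ 2 = b"
  "mat2 a b c d $ 2 $ 1 = c" "mat2 a b c d $ 2 $ 2 = d"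
  by (simp_all add: mat2_def)

lemma mat_eq_2_iff:
  "A = B \<longleftrightarrow> A $ 1 $ 1 = B $ 1 $ 1 \<and> A $ 1 $ 2 = B $ 1 $ 2 \<and>
             A $ 2 $ 1 = B $ 2 $ 1 \<and> A $ 2 $ 2 = B $ 2 $ 2"
  for A B :: "'a^2^2"
  by (auto simp: vec_eq_iff forall_2)

lemma mat2_cases:
  fixes A :: "'a::field^2^2"
  obtains a b c d where "A = mat2 a b c d"
  by (metis mat2_nth mat_eq_2_iff)

lemma mat2_mult [simp]:
  "mat2 a b c d ** mat2 a' b' c' d' =
     mat2 (a * a' + b * c') (a * b' + b * d') (c * a' + d * c') (c * b' + d * d')"
  by (simp add: mat_eq_2_iff matrix_matrix_mult_def sum_2)

lemma mat2_inject [simp]: "mat2 a b c d = mat2 a' b' c' d' \<longleftrightarrow> a = a' \<and> b = b' \<and> c = c' \<and> d = d'"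
  by (simp add: mat_eq_2_iff)

lemma trace_mat2 [simp]: "trace (mat2 a b c d) = a + d"
  by (simp add: trace_def sum_2)

lemma mat_1_eq_mat2: "mat 1 = mat2 1 0 0 1"
  by (simp add: mat_eq_2_iff mat_def)

lemma zero_eq_mat2: "0 = mat2 0 0 0 0"
  by (simp add: mat_eq_2_iff)

lemma invertible_mat2: "invertible (mat2 a b c d) \<longleftrightarrow> a * d - b * c \<noteq> 0"
  by (simp add: invertible_det_nz det_2)

text \<open>A nilpotent matrix is singular, and the positive powers of a singular matrix are
  multiples of it by powers of the trace, so trace and determinant both vanish. Conversely, if both
  vanish, the square is zero.\<close>

lemma nilpotent_matrix_mat2_iff:
  fixes a b c d :: "'a::field"
  shows "nilpotent_matrix (mat2 a b c d) \<longleftrightarrow> d = - a \<and> a * a + b * c = 0"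
proof
  let ?A = "mat2 a b c d"
  assume "nilpotent_matrix ?A"
  then obtain k where k: "(((**) ?A) ^^ k) (mat 1) = 0"
    unfolding nilpotent_matrix_def by blast
  have "det ((((**) ?A) ^^ n) (mat 1)) = det ?A ^ n" for n
    by (induction n) (auto simp: det_mul)
  from this[of k] have "det ?A ^ k = 0"
    unfolding k by (simp add: det_2)
  then have det: "a * d = b * c"
    by (simp add: det_2)
  \<comment> \<open>Cayley--Hamilton for a singular matrix\<close>
  have "(((**) ?A) ^^ Suc n) (mat 1) =
      mat2 ((a + d) ^ n * a) ((a + d) ^ n * b) ((a + d) ^ n * c) ((a + d) ^ n * d)" for n
  proof (induction n)
    case 0
    then show ?case by (simp add: mat_1_eq_mat2)
  next
    case (Suc n)
    have "a * ((a + d) ^ n * a) + b * ((a + d) ^ n * c) = (a + d) ^ n * (a * a + b * c)"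
      "c * ((a + d) ^ n * b) + d * ((a + d) ^ n * d) = (a + d) ^ n * (b * c + d * d)"
      by (simp_all add: algebra_simps)
    with Suc det show ?case
      by (subst funpow.simps) (simp add: algebra_simps)
  qed
  \<comment> \<open>The closed form starts at exponent one, so the vanishing power is raised by one
    to match it.\<close>
  moreover have "(((**) ?A) ^^ Suc k) (mat 1) = 0"
    using k by (simp add: matrix_matrix_mult_def vec_eq_iff)
  ultimately have "(a + d = 0) \<or> (a = 0 \<and> d = 0)"
    by (auto simp: zero_eq_mat2)
  then have "d = - a"
    by (metis add_0 minus_unique)
  with det show "d = - a \<and> a * a + b * c = 0"
    by (metis add.right_inverse mult_minus_right add.commute)
next
  assume *: "d = - a \<and> a * a + b * c = 0"
  then have "(((**) (mat2 a b c d)) ^^ 2) (mat 1) = 0"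
    by (auto simp: mat_1_eq_mat2 zero_eq_mat2 numeral_2_eq_2 algebra_simps)
  then show "nilpotent_matrix (mat2 a b c d)"
    unfolding nilpotent_matrix_def by blast
qed

lemma nilpotent_matrix_2_cases:
  fixes A :: "'a::field^2^2"
  assumes "nilpotent_matrix A"
  obtains p q r where "A = mat2 p q r (- p)" "p * p + q * r = 0"
  using assms mat2_cases[of A] nilpotent_matrix_mat2_iff by metis

section \<open>Traces and conjugation\<close>

lemma trace_mult_commute:
  fixes A B :: "'a::field^2^2"
  shows "trace (A ** B) = trace (B ** A)"
  by (cases A rule: mat2_cases, cases B rule: mat2_cases) (simp add: algebra_simps)

lemma trace_square_nilpotent:
  fixes A :: "'a::field^2^2"
  assumes "nilpotent_matrix A"
  shows "trace (A ** A) = 0"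
  using assms by (cases rule: nilpotent_matrix_2_cases) (auto simp: algebra_simps)

lemma zero_nilpotent: "nilpotent_matrix (0 :: 'a::field^2^2)"
  by (simp add: zero_eq_mat2 nilpotent_matrix_mat2_iff)

lemma matrix_inv:
  fixes g :: "'a::field^2^2"
  assumes "invertible g"
  shows "g ** matrix_inv g = mat 1" "matrix_inv g ** g = mat 1"
  using someI_ex[OF assms[unfolded invertible_def]] unfolding matrix_inv_def by auto

lemma conj_mult:
  fixes g A B :: "'a::field^2^2"
  assumes "invertible g"
  shows "(g ** A ** matrix_inv g) ** (g ** B ** matrix_inv g) = g ** (A ** B) ** matrix_inv g"
proof -
  have "(g ** A ** matrix_inv g) ** (g ** B ** matrix_inv g)
      = g ** A ** (matrix_inv g ** g) ** B ** matrix_inv g"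
    by (simp add: matrix_mul_assoc)
  with assms show ?thesis
    by (simp add: matrix_inv matrix_mul_assoc)
qed

lemma trace_conj:
  fixes g A :: "'a::field^2^2"
  assumes "invertible g"
  shows "trace (g ** A ** matrix_inv g) = trace A"
proof -
  have "trace (g ** A ** matrix_inv g) = trace (matrix_inv g ** g ** A)"
    by (metis trace_mult_commute matrix_mul_assoc)
  with assms show ?thesis
    by (simp add: matrix_inv)
qed

lemma nilpotent_conj:
  fixes g A :: "'a::field^2^2"
  assumes "invertible g" "nilpotent_matrix A"
  shows "nilpotent_matrix (g ** A ** matrix_inv g)"
proof -
  have "(((**) (g ** A ** matrix_inv g)) ^^ k) (mat 1) = g ** (((**) A) ^^ k) (mat 1) ** matrix_inv g"
    for k
    using assms(1) by (induction k) (simp_all add: conj_mult matrix_inv)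
  moreover have "g ** 0 ** matrix_inv g = 0"
    by (simp add: matrix_matrix_mult_def vec_eq_iff)
  ultimately show ?thesis
    using assms(2) unfolding nilpotent_matrix_def by metis
qed

text \<open>The intertwining relation spares computing \<open>matrix_inv g\<close>: conjugation by
  an explicit matrix becomes an identity between products of \<open>mat2\<close> terms.\<close>

lemma conj_eqI:
  fixes g A B :: "'a::field^2^2"
  assumes "invertible g" "g ** A = B ** g"
  shows "g ** A ** matrix_inv g = B"
  using assms by (metis matrix_inv(1) matrix_mul_assoc matrix_mul_rid)

section \<open>Normal forms of nilpotent matrices and pairs\<close>

text \<open>Choose a row vector w with w \<open>A\<close> nonzero. As \<open>A ** A = 0\<close>, the
  matrix with rows w and w \<open>A\<close> intertwines \<open>A\<close> with
  \<open>mat2 0 1 0 0\<close>. Here w is the second unit vector if \<open>r\<close> is nonzero, and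
  the first otherwise.\<close>

lemma nilpotent_conj_E12:
  fixes A :: "'a::field^2^2"
  assumes "nilpotent_matrix A" "A \<noteq> 0"
  obtains g where "invertible g" "g ** A ** matrix_inv g = mat2 0 1 0 0"
proof -
  obtain p q r where A: "A = mat2 p q r (- p)" "p * p + q * r = 0"
    using assms nilpotent_matrix_2_cases by blast
  show thesis
  proof (cases "r = 0")
    case True
    with A assms have "p = 0" "q \<noteq> 0"
      by (auto simp: zero_eq_mat2)
    with A True show thesis
      by (intro that[of "mat2 1 0 0 q"] conj_eqI) (auto simp: invertible_mat2)
  next
    case False
    with A show thesis
      by (intro that[of "mat2 0 1 r (- p)"] conj_eqI) (auto simp: invertible_mat2 algebra_simps)
  qed
qed

text \<open>Once \<open>A\<close> is in normal form, the trace condition fixes the lower left entry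
  of the other matrix as \<open>c\<close>. The stabiliser of the first matrix still leaves enough
  freedom to clear the diagonal of the second.\<close>

lemma nilpotent_pair_conj:
  fixes A B :: "'a::field^2^2"
  assumes "nilpotent_matrix A" "nilpotent_matrix B" "trace (A ** B) = c" "c \<noteq> 0"
  obtains g where "invertible g" "g ** A ** matrix_inv g = mat2 0 1 0 0"
    "g ** B ** matrix_inv g = mat2 0 0 c 0"
proof -
  have "A \<noteq> 0"
    using assms by (auto simp: matrix_matrix_mult_def trace_def)
  then obtain h where h: "invertible h" "h ** A ** matrix_inv h = mat2 0 1 0 0"
    using assms nilpotent_conj_E12 by blast
  define B' where "B' = h ** B ** matrix_inv h"
  have "nilpotent_matrix B'"
    unfolding B'_def using h assms by (intro nilpotent_conj)
  then obtain p q r where B': "B' = mat2 p q r (- p)" "p * p + q * r = 0"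
    using nilpotent_matrix_2_cases by blast
  have "trace (mat2 0 1 0 0 ** B') = c"
    unfolding B'_def h(2)[symmetric] using h(1) assms(3)
    by (simp add: conj_mult trace_conj)
  with B' have r: "r = c"
    by simp
  \<comment> \<open>Upper unipotent matrices commute with \<open>mat2 0 1 0 0\<close>; the parameter
    is chosen so that conjugation removes the diagonal of \<open>B'\<close>.\<close>
  define u where "u = mat2 1 (- p / c) 0 1"
  have u: "invertible u"
    by (simp add: u_def invertible_mat2)
  have q: "q = - p * p / c"
    using B' r assms(4) by (simp add: field_simps eq_neg_iff_add_eq_0)
  have uE: "u ** mat2 0 1 0 0 = mat2 0 1 0 0 ** u" and uB: "u ** B' = mat2 0 0 c 0 ** u"
    using assms(4) by (simp_all add: u_def B' r q)
  \<comment> \<open>The two conjugations are composed through intertwining relations, so the inverse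
    of a product never has to be expanded.\<close>
  have gen: "(u ** h) ** X ** matrix_inv (u ** h) = Y"
    if "h ** X ** matrix_inv h = Z" "u ** Z = Y ** u" for X Y Z
  proof (rule conj_eqI)
    show "invertible (u ** h)"
      using u h by (intro invertible_mult)
    have "h ** X = Z ** h"
      using that(1) h(1) by (metis matrix_inv(2) matrix_mul_assoc matrix_mul_rid)
    then show "u ** h ** X = Y ** (u ** h)"
      using that(2) by (metis matrix_mul_assoc)
  qed
  show thesis
    using that[of "u ** h"] gen[OF h(2) uE] gen[OF B'_def[symmetric] uB] u h(1) invertible_mult
    by blast
qed

section \<open>Nilpotent tuples and the invariance of traces\<close>

lemma nil_tuples_nilpotent: "A \<in> nil_tuples m \<Longrightarrow> k \<in> {1..m} \<Longrightarrow> nilpotent_matrix (A k)"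
  by (auto simp: nil_tuples_def)

lemma nil_tuples_restrict:
  "(\<And>k. k \<in> {1..m} \<Longrightarrow> nilpotent_matrix (A k)) \<Longrightarrow> (\<lambda>k\<in>{1..m}. A k) \<in> nil_tuples m"
  by (auto simp: nil_tuples_def)

lemma conj_act_nil_tuples:
  "invertible g \<Longrightarrow> A \<in> nil_tuples m \<Longrightarrow> conj_act m g A \<in> nil_tuples m"
  unfolding conj_act_def by (intro nil_tuples_restrict nilpotent_conj nil_tuples_nilpotent)

lemma trace_pair_conj_act:
  assumes "invertible g" "i \<in> {1..m}" "j \<in> {1..m}"
  shows "trace (conj_act m g A i ** conj_act m g A j) = trace (A i ** A j)"
  using assms by (simp add: conj_act_def conj_mult trace_conj)

lemma trace_triple_conj_act:
  assumes "invertible g" "i \<in> {1..m}" "j \<in> {1..m}" "k \<in> {1..m}"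
  shows "trace (conj_act m g A i ** conj_act m g A j ** conj_act m g A k) = trace (A i ** A j ** A k)"
  using assms by (simp add: conj_act_def conj_mult trace_conj)

lemma invariant_algebra_conj:
  "f \<in> invariant_algebra m \<Longrightarrow> invertible g \<Longrightarrow> A \<in> nil_tuples m \<Longrightarrow> f (conj_act m g A) = f A"
  by (simp add: invariant_algebra_def)

text \<open>The rules of \<open>coord_algebra\<close> produce nested restrictions. Stripping the
  inner ones lets closure be applied backwards to a polynomial expression under a single
  restriction.\<close>

lemma coord_algebra_add_restrict:
  assumes "restrict f (nil_tuples m) \<in> coord_algebra m" "restrict h (nil_tuples m) \<in> coord_algebra m"
  shows "(\<lambda>A\<in>nil_tuples m. f A + h A) \<in> coord_algebra m"
  using coord_algebra.add[OF assms] by (simp cong: restrict_cong)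

lemma coord_algebra_mult_restrict:
  assumes "restrict f (nil_tuples m) \<in> coord_algebra m" "restrict h (nil_tuples m) \<in> coord_algebra m"
  shows "(\<lambda>A\<in>nil_tuples m. f A * h A) \<in> coord_algebra m"
  using coord_algebra.mult[OF assms] by (simp cong: restrict_cong)

lemma trace_pairs_invariant: "trace_pairs m \<subseteq> invariant_algebra m"
  unfolding trace_pairs_def invariant_algebra_def
  by (auto simp: conj_act_nil_tuples trace_pair_conj_act)
     (auto simp: trace_def matrix_matrix_mult_def sum_2
       intro!: coord_algebra_add_restrict coord_algebra_mult_restrict coord_algebra.entry)

lemma trace_triples_invariant: "trace_triples m \<subseteq> invariant_algebra m"
  unfolding trace_triples_def invariant_algebra_def
  by (auto simp: conj_act_nil_tuples trace_triple_conj_act)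
     (auto simp: trace_def matrix_matrix_mult_def sum_2
       intro!: coord_algebra_add_restrict coord_algebra_mult_restrict coord_algebra.entry)

section \<open>Tuples whose pair traces all vanish\<close>

text \<open>For fixed \<open>a\<close> this is a line through the zero tuple. Its points with
  \<open>t\<close> nonzero are conjugate to each other, so invariants are compared along it.\<close>

definition scaled_E12 :: "nat \<Rightarrow> (nat \<Rightarrow> 'a::field) \<Rightarrow> 'a \<Rightarrow> nat \<Rightarrow> 'a^2^2" where
  "scaled_E12 m a t = (\<lambda>k\<in>{1..m}. mat2 0 (t * a k) 0 0)"

lemma scaled_E12_nil_tuples: "scaled_E12 m a t \<in> nil_tuples m"
  unfolding scaled_E12_def by (intro nil_tuples_restrict) (simp add: nilpotent_matrix_mat2_iff)

text \<open>Reduces the study of an invariant along the line to one variable, where the finiteness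
  of root sets brings in the infinite field.\<close>

lemma coord_algebra_poly:
  fixes f :: "(nat \<Rightarrow> 'a::field^2^2) \<Rightarrow> 'a"
  assumes "f \<in> coord_algebra m"
  shows "\<exists>p. \<forall>t. f (scaled_E12 m a t) = poly p t"
  using assms
proof induction
  case (const c)
  then show ?case
    by (intro exI[of _ "[:c:]"]) (simp add: scaled_E12_nil_tuples)
next
  case (entry k i j)
  have "i = 1 \<or> i = 2" "j = 1 \<or> j = 2"
    using exhaust_2 by blast+
  with entry show ?case
    by (intro exI[of _ "if i = 1 \<and> j = 2 then [:0, a k:] else 0"])
       (auto simp: scaled_E12_nil_tuples, auto simp: scaled_E12_def)
next
  case (add f h)
  then obtain p q where "\<And>t. f (scaled_E12 m a t) = poly p t" "\<And>t. h (scaled_E12 m a t) = poly q t"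
    by blast
  then show ?case
    by (intro exI[of _ "p + q"]) (simp add: scaled_E12_nil_tuples)
next
  case (mult f h)
  then obtain p q where "\<And>t. f (scaled_E12 m a t) = poly p t" "\<And>t. h (scaled_E12 m a t) = poly q t"
    by blast
  then show ?case
    by (intro exI[of _ "p * q"]) (simp add: scaled_E12_nil_tuples)
qed

lemma invariant_null_tuple:
  fixes f :: "(nat \<Rightarrow> 'a::field^2^2) \<Rightarrow> 'a"
  assumes inf: "infinite (UNIV :: 'a set)" and f: "f \<in> invariant_algebra m"
    and A: "A \<in> nil_tuples m"
    and tr: "\<And>i j. i \<in> {1..m} \<Longrightarrow> j \<in> {1..m} \<Longrightarrow> trace (A i ** A j) = 0"
  shows "f A = f (\<lambda>k\<in>{1..m}. 0)"
proof (cases "\<exists>i\<in>{1..m}. A i \<noteq> 0")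
  case False
  with A have "A = (\<lambda>k\<in>{1..m}. 0)"
    by (auto simp: nil_tuples_def PiE_iff extensional_def)
  then show ?thesis by simp
next
  case True
  then obtain i where i: "i \<in> {1..m}" "A i \<noteq> 0" by blast
  then obtain g where g: "invertible g" "g ** A i ** matrix_inv g = mat2 0 1 0 0"
    using A nil_tuples_nilpotent nilpotent_conj_E12 by metis
  define C where "C = conj_act m g A"
  have C: "C \<in> nil_tuples m"
    unfolding C_def using g A by (intro conj_act_nil_tuples)
  have Ci: "C i = mat2 0 1 0 0"
    using i g by (simp add: C_def conj_act_def)
  \<comment> \<open>The trace against \<open>C i\<close> is the lower left entry of
    \<open>C k\<close>; when it is zero, nilpotency makes the diagonal vanish too.\<close>
  have Ck: "C k = mat2 0 (C k $ 1 $ 2) 0 0" if k: "k \<in> {1..m}" for k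
  proof -
    obtain p q r where Ck: "C k = mat2 p q r (- p)" "p * p + q * r = 0"
      using C k nil_tuples_nilpotent nilpotent_matrix_2_cases by blast
    have "trace (C i ** C k) = 0"
      unfolding C_def using g i k tr by (simp add: trace_pair_conj_act)
    with Ck Ci show ?thesis by simp
  qed
  define a where "a k = C k $ 1 $ 2" for k
  have C1: "C = scaled_E12 m a 1"
  proof
    fix k
    show "C k = scaled_E12 m a 1 k"
      using Ck[of k] C by (cases "k \<in> {1..m}") (auto simp: scaled_E12_def a_def nil_tuples_def)
  qed
  obtain p where p: "\<And>t. f (scaled_E12 m a t) = poly p t"
    using f coord_algebra_poly unfolding invariant_algebra_def by blast
  \<comment> \<open>Conjugation by the diagonal matrix with entries \<open>t\<close> and 1
    multiplies the upper right entry by \<open>t\<close> and thus moves \<open>C\<close> along the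
    line.\<close>
  have const: "poly p t = poly p 1" if "t \<noteq> 0" for t
  proof -
    have inv: "invertible (mat2 t 0 0 1)"
      using that by (simp add: invertible_mat2)
    have "conj_act m (mat2 t 0 0 1) C = scaled_E12 m a t"
      unfolding conj_act_def scaled_E12_def C1
      using inv by (intro restrict_ext conj_eqI) auto
    then show ?thesis
      using invariant_algebra_conj[OF f inv C] p C1 by metis
  qed
  have "poly (p - [:poly p 1:]) t = 0" if "t \<noteq> 0" for t
    using const[OF that] by simp
  \<comment> \<open>Conjugacy covers only nonzero \<open>t\<close>. The infinitely many roots extend
    the equality to \<open>t = 0\<close>, which is the zero tuple.\<close>
  then have "UNIV - {0} \<subseteq> {t. poly (p - [:poly p 1:]) t = 0}"
    by blast
  moreover have "infinite (UNIV - {0 :: 'a})"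
    using inf by simp
  ultimately have "p - [:poly p 1:] = 0"
    using poly_roots_finite finite_subset by blast
  then have "poly (p - [:poly p 1:]) 0 = 0"
    by (simp only: poly_0)
  then have "poly p 0 = poly p 1"
    by simp
  moreover have "f A = f C"
    unfolding C_def using invariant_algebra_conj[OF f g(1) A] by simp
  moreover have "scaled_E12 m a 0 = (\<lambda>k\<in>{1..m}. 0)"
    by (simp add: scaled_E12_def zero_eq_mat2)
  ultimately show ?thesis
    using p C1 by metis
qed

section \<open>Equal traces force equal invariants\<close>

text \<open>The premise on triples is conditional so that one statement serves both
  characteristics.\<close>

lemma invariants_eq:
  fixes f :: "(nat \<Rightarrow> 'a::field^2^2) \<Rightarrow> 'a"
  assumes inf: "infinite (UNIV :: 'a set)" and f: "f \<in> invariant_algebra m"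
    and A: "A \<in> nil_tuples m" and B: "B \<in> nil_tuples m"
    and pairs: "\<And>i j. 1 \<le> i \<Longrightarrow> i < j \<Longrightarrow> j \<le> m \<Longrightarrow> trace (A i ** A j) = trace (B i ** B j)"
    and triples: "CHAR('a) \<noteq> 2 \<Longrightarrow> (\<And>i j k. 1 \<le> i \<Longrightarrow> i < j \<Longrightarrow> j < k \<Longrightarrow> k \<le> m \<Longrightarrow>
      trace (A i ** A j ** A k) = trace (B i ** B j ** B k))"
  shows "f A = f B"
proof -
  have pairs': "trace (A i ** A j) = trace (B i ** B j)" if "i \<in> {1..m}" "j \<in> {1..m}" for i j
    using that pairs[of i j] pairs[of j i] A B
    by (cases i j rule: linorder_cases)
       (auto simp: trace_mult_commute[of "_ i" "_ j"] trace_square_nilpotent nil_tuples_nilpotent)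
  show ?thesis
  proof (cases "\<exists>i j. 1 \<le> i \<and> i < j \<and> j \<le> m \<and> trace (A i ** A j) \<noteq> 0")
    case False
    have "trace (A i ** A j) = 0" if "i \<in> {1..m}" "j \<in> {1..m}" for i j
      using that False A trace_mult_commute[of "A i" "A j"]
      by (cases i j rule: linorder_cases) (auto simp: trace_square_nilpotent nil_tuples_nilpotent)
    \<comment> \<open>By \<open>pairs'\<close> the pair traces of \<open>B\<close> vanish as well,
      so \<open>f\<close> takes its value at the zero tuple on both sides.\<close>
    then show ?thesis
      using invariant_null_tuple[OF inf f] A B pairs' by metis
  next
    case True
    then obtain i j where ij: "1 \<le> i" "i < j" "j \<le> m" and nz: "trace (A i ** A j) \<noteq> 0"
      by blast
    then have mem: "i \<in> {1..m}" "j \<in> {1..m}" by auto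
    define c where "c = trace (A i ** A j)"
    have c: "c \<noteq> 0" "trace (A i ** A j) = c" "trace (B i ** B j) = c"
      using nz pairs[OF ij] by (auto simp: c_def)
    obtain g where g: "invertible g" "g ** A i ** matrix_inv g = mat2 0 1 0 0"
      "g ** A j ** matrix_inv g = mat2 0 0 c 0"
      using nilpotent_pair_conj[OF nil_tuples_nilpotent[OF A mem(1)] nil_tuples_nilpotent[OF A mem(2)] c(2,1)]
      by metis
    obtain h where h: "invertible h" "h ** B i ** matrix_inv h = mat2 0 1 0 0"
      "h ** B j ** matrix_inv h = mat2 0 0 c 0"
      using nilpotent_pair_conj[OF nil_tuples_nilpotent[OF B mem(1)] nil_tuples_nilpotent[OF B mem(2)] c(3,1)]
      by metis
    \<comment> \<open>Both tuples are normalised at the same indices \<open>i\<close> and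
      \<open>j\<close>. Since \<open>f\<close> is invariant, it then suffices that
      \<open>C = D\<close>.\<close>
    define C where "C = conj_act m g A"
    define D where "D = conj_act m h B"
    have C: "C \<in> nil_tuples m" and D: "D \<in> nil_tuples m"
      unfolding C_def D_def using g h A B by (auto intro: conj_act_nil_tuples)
    have ij_eq: "C i = mat2 0 1 0 0" "C j = mat2 0 0 c 0" "D i = mat2 0 1 0 0" "D j = mat2 0 0 c 0"
      using g h mem by (auto simp: C_def D_def conj_act_def)
    have "C k = D k" if k: "k \<in> {1..m}" for k
    proof -
      obtain p q r where Ck: "C k = mat2 p q r (- p)" "p * p + q * r = 0"
        using C k nil_tuples_nilpotent nilpotent_matrix_2_cases by blast
      obtain p' q' r' where Dk: "D k = mat2 p' q' r' (- p')" "p' * p' + q' * r' = 0"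
        using D k nil_tuples_nilpotent nilpotent_matrix_2_cases by blast
      have pairs'': "trace (C l ** C k) = trace (D l ** D k)" if "l \<in> {1..m}" for l
        unfolding C_def D_def using g h k that pairs' by (simp add: trace_pair_conj_act)
      \<comment> \<open>The trace against entry \<open>i\<close> reads off the lower left entry;
        against entry \<open>j\<close> it gives \<open>c\<close> times the upper right one.\<close>
      have r: "r = r'"
        using pairs''[OF mem(1)] by (simp add: ij_eq Ck Dk)
      have q: "q = q'"
        using pairs''[OF mem(2)] c by (simp add: ij_eq Ck Dk)
      have "p = p'"
      proof (cases "CHAR('a) = 2")
        case True
        then have "of_nat 2 = (0 :: 'a)"
          by (metis of_nat_CHAR)
        then have two: "p + p = 0"
          by (metis mult_2 mult_zero_left of_nat_numeral)
        \<comment> \<open>Nilpotency with equal off-diagonal entries gives equal squares; because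
          \<open>p + p = 0\<close>, the vanishing of either factor means
          \<open>p = p'\<close>.\<close>
        have "(p - p') * (p + p') = 0"
          using Ck Dk r q by (simp add: algebra_simps add_eq_0_iff)
        with two show ?thesis
          by (metis add_left_cancel eq_iff_diff_eq_0 mult_eq_0_iff)
      next
        case False
        have tr: "trace (C a ** C b ** C d) = trace (D a ** D b ** D d)"
          if "1 \<le> a" "a < b" "b < d" "d \<le> m" for a b d
          unfolding C_def D_def using g h that triples[OF False that]
          by (simp add: trace_triple_conj_act)
        \<comment> \<open>Triple traces are given for increasing indices only. They equal
          \<open>c * p\<close> if \<open>k\<close> lies before or after both \<open>i\<close> and
          \<open>j\<close>, and \<open>- (c * p)\<close> if it lies between them.\<close>
        consider "k = i" | "k = j" | "k < i" | "i < k" "k < j" | "j < k"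
          by linarith
        then show ?thesis
        proof cases
          case 1
          then show ?thesis using ij_eq Ck Dk by simp
        next
          case 2
          then show ?thesis using ij_eq Ck Dk by simp
        next
          case 3
          then show ?thesis
            using tr[of k i j] k ij c by (simp add: ij_eq Ck Dk)
        next
          case 4
          then show ?thesis
            using tr[of i k j] k ij c by (simp add: ij_eq Ck Dk)
        next
          case 5
          then show ?thesis
            using tr[of i j k] k ij c by (simp add: ij_eq Ck Dk)
        qed
      qed
      with q r Ck Dk show ?thesis by simp
    qed
    then have "C = D"
      using C D unfolding nil_tuples_def by (metis PiE_ext)
    then show ?thesis
      using invariant_algebra_conj[OF f g(1) A] invariant_algebra_conj[OF f h(1) B]
      by (simp add: C_def D_def)
  qed
qed

section \<open>The separating property\<close>

lemma separates_trace_pairs: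
  fixes A B :: "nat \<Rightarrow> 'a::field^2^2"
  assumes "\<not> separates (trace_pairs m) A B" "A \<in> nil_tuples m" "B \<in> nil_tuples m"
    and "1 \<le> i" "i < j" "j \<le> m"
  shows "trace (A i ** A j) = trace (B i ** B j)"
proof -
  let ?f = "\<lambda>A\<in>nil_tuples m. trace (A i ** A j :: 'a^2^2)"
  have "?f \<in> trace_pairs m"
    unfolding trace_pairs_def using assms(4-) by blast
  with assms(1) have "?f A = ?f B"
    unfolding separates_def by blast
  with assms(2,3) show ?thesis by simp
qed

lemma separates_trace_triples:
  fixes A B :: "nat \<Rightarrow> 'a::field^2^2"
  assumes "\<not> separates (trace_triples m) A B" "A \<in> nil_tuples m" "B \<in> nil_tuples m"
    and "1 \<le> i" "i < j" "j < k" "k \<le> m"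
  shows "trace (A i ** A j ** A k) = trace (B i ** B j ** B k)"
proof -
  let ?f = "\<lambda>A\<in>nil_tuples m. trace (A i ** A j ** A k :: 'a^2^2)"
  have "?f \<in> trace_triples m"
    unfolding trace_triples_def using assms(4-) by blast
  with assms(1) have "?f A = ?f B"
    unfolding separates_def by blast
  with assms(2,3) show ?thesis by simp
qed

lemma separates_Un: "separates (S \<union> T) A B \<longleftrightarrow> separates S A B \<or> separates T A B"
  by (auto simp: separates_def)

lemma trace_pairs_separating:
  assumes "infinite (UNIV :: 'a::field set)" "CHAR('a) = 2"
  shows "separating_set m (trace_pairs m :: ((nat \<Rightarrow> 'a^2^2) \<Rightarrow> 'a) set)"
  unfolding separating_set_def
proof (intro conjI ballI impI trace_pairs_invariant)
  fix A B :: "nat \<Rightarrow> 'a^2^2"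
  assume AB: "A \<in> nil_tuples m" "B \<in> nil_tuples m" "separates (invariant_algebra m) A B"
  then obtain f where f: "f \<in> invariant_algebra m" "f A \<noteq> f B"
    unfolding separates_def by blast
  show "separates (trace_pairs m) A B"
  proof (rule ccontr)
    assume not: "\<not> ?thesis"
    have "f A = f B"
      \<comment> \<open>\<open>assms(2)\<close> discharges the premise on triples, which is
        conditional on the other characteristics.\<close>
      using assms(2) by (intro invariants_eq[OF assms(1) f(1) AB(1,2)]
          separates_trace_pairs[OF not AB(1,2)]) auto
    with f show False by simp
  qed
qed

lemma trace_pairs_triples_separating:
  assumes "infinite (UNIV :: 'a::field set)"
  shows "separating_set m (trace_pairs m \<union> trace_triples m :: ((nat \<Rightarrow> 'a^2^2) \<Rightarrow> 'a) set)"
  unfolding separating_set_def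
proof (intro conjI ballI impI Un_least trace_pairs_invariant trace_triples_invariant)
  fix A B :: "nat \<Rightarrow> 'a^2^2"
  assume AB: "A \<in> nil_tuples m" "B \<in> nil_tuples m" "separates (invariant_algebra m) A B"
  then obtain f where f: "f \<in> invariant_algebra m" "f A \<noteq> f B"
    unfolding separates_def by blast
  show "separates (trace_pairs m \<union> trace_triples m) A B"
  proof (rule ccontr)
    assume "\<not> ?thesis"
    then have not: "\<not> separates (trace_pairs m) A B" "\<not> separates (trace_triples m) A B"
      by (simp_all add: separates_Un)
    have "f A = f B"
      by (intro invariants_eq[OF assms(1) f(1) AB(1,2)]
          separates_trace_pairs[OF not(1) AB(1,2)] separates_trace_triples[OF not(2) AB(1,2)])
    with f show False by simp
  qed
qed

section \<open>Minimality\<close>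

text \<open>Two points at which \<open>f\<close> alone among the members of \<open>S\<close> differs
  are separated by an invariant but by no subset of \<open>S\<close> that omits
  \<open>f\<close>.\<close>

lemma minimal_separating_setI:
  assumes S: "separating_set m S"
    and witness: "\<And>f. f \<in> S \<Longrightarrow> \<exists>A\<in>nil_tuples m. \<exists>B\<in>nil_tuples m. f A \<noteq> f B \<and> (\<forall>h\<in>S. h \<noteq> f \<longrightarrow> h A = h B)"
  shows "minimal_separating_set m S"
  unfolding minimal_separating_set_def
proof (intro conjI S allI impI notI)
  fix T assume T: "T \<subset> S" "separating_set m T"
  then obtain f where f: "f \<in> S" "f \<notin> T" by blast
  then obtain A B where AB: "A \<in> nil_tuples m" "B \<in> nil_tuples m" "f A \<noteq> f B"
    "\<forall>h\<in>S. h \<noteq> f \<longrightarrow> h A = h B"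
    using witness by blast
  then have "separates (invariant_algebra m) A B"
    using S f unfolding separating_set_def separates_def by blast
  then have "separates T A B"
    using T AB unfolding separating_set_def by blast
  then show False
    using T f AB unfolding separates_def by (metis psubsetD)
qed

lemma zero_matrix_mult [simp]: "0 ** A = 0" "A ** 0 = 0" "trace 0 = 0"
  for A :: "'a::field^2^2"
  by (simp_all add: matrix_matrix_mult_def vec_eq_iff trace_def)

text \<open>A tuple supported on the two indices of \<open>f\<close> is compared with the zero
  tuple: every other pair, and every triple, involves a zero matrix. Covering triples as well makes
  the witness usable in both characteristics.\<close>

lemma pair_witness:
  fixes f :: "(nat \<Rightarrow> 'a::field^2^2) \<Rightarrow> 'a"
  assumes "f \<in> trace_pairs m"
  shows "\<exists>A\<in>nil_tuples m. \<exists>B\<in>nil_tuples m. f A \<noteq> f B \<and>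
    (\<forall>h\<in>trace_pairs m \<union> trace_triples m. h \<noteq> f \<longrightarrow> h A = h B)"
proof -
  obtain i j where ij: "1 \<le> i" "i < j" "j \<le> m"
    and f: "f = (\<lambda>A\<in>nil_tuples m. trace (A i ** A j))"
    using assms unfolding trace_pairs_def by blast
  define A :: "nat \<Rightarrow> 'a^2^2" where
    "A = (\<lambda>k\<in>{1..m}. if k = i then mat2 0 1 0 0 else if k = j then mat2 0 0 1 0 else 0)"
  define B :: "nat \<Rightarrow> 'a^2^2" where "B = (\<lambda>k\<in>{1..m}. 0)"
  have A: "A \<in> nil_tuples m" and B: "B \<in> nil_tuples m"
    unfolding A_def B_def
    by (intro nil_tuples_restrict; simp add: nilpotent_matrix_mat2_iff zero_nilpotent)+
  have "f A \<noteq> f B"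
    using ij A B unfolding f by simp (simp add: A_def B_def)
  moreover have "h A = h B" if h: "h \<in> trace_pairs m" "h \<noteq> f" for h
  proof -
    obtain k l where kl: "1 \<le> k" "k < l" "l \<le> m"
      and h': "h = (\<lambda>A\<in>nil_tuples m. trace (A k ** A l))"
      using h(1) unfolding trace_pairs_def by blast
    then have "(k, l) \<noteq> (i, j)"
      using h(2) f by auto
    then show ?thesis
      using ij kl A B unfolding h' by simp (auto simp: A_def B_def)
  qed
  moreover have "h A = h B" if h: "h \<in> trace_triples m" for h
  proof -
    obtain k l n where kl: "1 \<le> k" "k < l" "l < n" "n \<le> m"
      and h': "h = (\<lambda>A\<in>nil_tuples m. trace (A k ** A l ** A n))"
      using h unfolding trace_triples_def by blast
    then show ?thesis
      using ij A B unfolding h' by simp (auto simp: A_def B_def)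
  qed
  ultimately show ?thesis
    using A B by blast
qed

text \<open>Two tuples that differ only in the sign of one diagonal have the same pair traces, while
  the chosen triple trace is that diagonal entry, 1 or -1.\<close>

lemma triple_witness:
  fixes f :: "(nat \<Rightarrow> 'a::field^2^2) \<Rightarrow> 'a"
  assumes "CHAR('a) \<noteq> 2" "f \<in> trace_triples m"
  shows "\<exists>A\<in>nil_tuples m. \<exists>B\<in>nil_tuples m. f A \<noteq> f B \<and>
    (\<forall>h\<in>trace_pairs m \<union> trace_triples m. h \<noteq> f \<longrightarrow> h A = h B)"
proof -
  have two: "(1 :: 'a) \<noteq> - 1"
  proof
    assume "(1 :: 'a) = - 1"
    then have "of_nat 2 = (0 :: 'a)"
      by (simp add: eq_neg_iff_add_eq_0)
    then have "CHAR('a) dvd 2"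
      using of_nat_eq_0_iff_char_dvd by blast
    then have "CHAR('a) = 1 \<or> CHAR('a) = 2"
      by (metis prime_nat_iff two_is_prime_nat)
    then show False
      using assms(1) CHAR_not_1' by auto
  qed
  obtain i j k where ijk: "1 \<le> i" "i < j" "j < k" "k \<le> m"
    and f: "f = (\<lambda>A\<in>nil_tuples m. trace (A i ** A j ** A k))"
    using assms(2) unfolding trace_triples_def by blast
  \<comment> \<open>The first two matrices are the normal form with \<open>c = 1\<close>. The
    off-diagonal entries of the third are fixed, and nilpotency then asks for
    \<open>s * s = 1\<close>.\<close>
  define A :: "'a \<Rightarrow> nat \<Rightarrow> 'a^2^2" where
    "A s = (\<lambda>l\<in>{1..m}. if l = i then mat2 0 1 0 0 else if l = j then mat2 0 0 1 0
      else if l = k then mat2 s (- 1) 1 (- s) else 0)" for s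
  have A: "A s \<in> nil_tuples m" if "s * s = 1" for s
    unfolding A_def using that
    by (intro nil_tuples_restrict) (simp add: nilpotent_matrix_mat2_iff zero_nilpotent)
  have A1: "A 1 \<in> nil_tuples m" and A2: "A (- 1) \<in> nil_tuples m"
    by (rule A; simp)+
  have "f (A 1) \<noteq> f (A (- 1))"
    using ijk A1 A2 two unfolding f by simp (simp add: A_def)
  moreover have "h (A 1) = h (A (- 1))" if h: "h \<in> trace_pairs m" for h
  proof -
    obtain a b where "1 \<le> a" "a < b" "b \<le> m"
      and h': "h = (\<lambda>A\<in>nil_tuples m. trace (A a ** A b))"
      using h unfolding trace_pairs_def by blast
    then show ?thesis
      using ijk A1 A2 unfolding h' by simp (auto simp: A_def)
  qed
  moreover have "h (A 1) = h (A (- 1))" if h: "h \<in> trace_triples m" "h \<noteq> f" for h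
  proof -
    obtain a b d where abd: "1 \<le> a" "a < b" "b < d" "d \<le> m"
      and h': "h = (\<lambda>A\<in>nil_tuples m. trace (A a ** A b ** A d))"
      using h(1) unfolding trace_triples_def by blast
    then have "(a, b, d) \<noteq> (i, j, k)"
      using h(2) f by auto
    \<comment> \<open>Distinct increasing triples differ as sets, so some index lies outside the
      support.\<close>
    with abd ijk have "a \<notin> {i, j, k} \<or> b \<notin> {i, j, k} \<or> d \<notin> {i, j, k}"
      by auto
    with abd have "trace (A s a ** A s b ** A s d) = 0" for s
      by (auto simp: A_def)
    then show ?thesis
      using A1 A2 unfolding h' by simp
  qed
  ultimately show ?thesis
    using A1 A2 by blast
qed

theorem theorem5p4:
  fixes m :: nat
  assumes "infinite (UNIV :: 'a::field set)"
    and "m > 0"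
  shows "(CHAR('a) = 2 \<longrightarrow>
            minimal_separating_set m (trace_pairs m :: ((nat \<Rightarrow> 'a^2^2) \<Rightarrow> 'a) set)) \<and>
         (CHAR('a) \<noteq> 2 \<longrightarrow>
            minimal_separating_set m
              (trace_pairs m \<union> trace_triples m :: ((nat \<Rightarrow> 'a^2^2) \<Rightarrow> 'a) set))"
proof (intro conjI impI)
  assume "CHAR('a) = 2"
  with assms show "minimal_separating_set m (trace_pairs m :: ((nat \<Rightarrow> 'a^2^2) \<Rightarrow> 'a) set)"
    by (intro minimal_separating_setI trace_pairs_separating) (use pair_witness in blast)+
next
  assume "CHAR('a) \<noteq> 2"
  with assms show "minimal_separating_set m
      (trace_pairs m \<union> trace_triples m :: ((nat \<Rightarrow> 'a^2^2) \<Rightarrow> 'a) set)"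
    by (intro minimal_separating_setI trace_pairs_triples_separating)
       (use pair_witness triple_witness in blast)+
qed

end
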